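(* Let $G=(V,E)$ be a finite simple graph. If the minimum degree of $G$ satisfies $$\delta(G) \geq \frac{2|V|}{3} - 1,$$ then $Ric(G) \geq 0$, i.e. the Lin-Lu-Yau curvature satisfies $\kappa(x,y) \geq 0$ for every edge $x \sim y$ of $G$.
   Context: Graphs are simple: unweighted, undirected, without multiple edges or self-loops, with nonempty vertex set. Write $x\sim y$ if $x,y\in V$ are joined by an edge. The combinatorial graph distance is $d(x,y)=\inf\{n : x=x_0\sim x_1\sim\dots\sim x_n=y\}$ (with $\inf\emptyset=\infty$). The degree $d_x$ of a vertex $x$ is its number of neighbors, and $\delta(G)=\min_{x\in V} d_x$. For probability measures $\mu_1,\mu_2$ on $V$, the Wasserstein distance is $$W_1(\mu_1,\mu_2)=\inf_{\pi\in\Pi(\mu_1,\mu_2)}\sum_{x\in V}\sum_{y\in V} d(x,y)\,\pi(x,y),$$ where $\Pi(\mu_1,\mu_2)$ is the set of $\pi:V\times V\to[0,1]$ with $\sum_{y\in V}\pi(x,y)=\mu_1(x)$ for all $x$ and $\sum_{x\in V}\pi(x,y)=\mu_2(y)$ for all $y$ (with the convention $\infty\cdot 0=0$). For $\alpha\in[0,1]$ and a vertex $x$ with $d_x\ge 1$, let $\mu_x^\alpha$ be the probability measure on $V$ given by $\mu_x^\alpha(x)=\alpha$, $\mu_x^\alpha(y)=\frac{1-\alpha}{d_x}$ if $y\sim x$, and $\mu_x^\alpha(y)=0$ otherwise. For an edge $x\sim y$, the $\alpha$-Ollivier-Ricci curvature is $\kappa_\alpha(x,y)=1-W_1(\mu_x^\alpha,\mu_y^\alpha)$,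 and the Lin-Lu-Yau curvature is $$\kappa(x,y)=\lim_{\alpha\to 1}\frac{\kappa_\alpha(x,y)}{1-\alpha}$$ (limit as $\alpha\uparrow 1$, $\alpha<1$; this limit is known to exist). For a real number $k$, $Ric(G)\ge k$ means $\kappa(x,y)\ge k$ for all edges $x\sim y$ of $G$. *)

theory Defs
  imports "HOL-Analysis.Analysis" "Graph_Theory.Pair_Digraph" "Graph_Theory.Shortest_Path"
begin

text \<open>
  A finite simple graph is a \<^locale>\<open>pair_graph\<close>: the vertices are \<^term>\<open>pverts G\<close>, and
  \<^term>\<open>parcs G\<close> is a symmetric and irreflexive relation on them, so that an undirected edge
  joining x and y is represented by the two arcs (x, y) and (y, x).  The sums, the degree and
  the minimum below are only meaningful for finite graphs.
\<close>

definition neighbors :: "'a pair_pre_digraph \<Rightarrow> 'a \<Rightarrow> 'a set" where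
  "neighbors G x = {y \<in> pverts G. (x, y) \<in> parcs G}"

definition degree :: "'a pair_pre_digraph \<Rightarrow> 'a \<Rightarrow> nat" where
  "degree G x = card (neighbors G x)"

definition min_degree :: "'a pair_pre_digraph \<Rightarrow> nat" where
  "min_degree G = Min (degree G ` pverts G)"

text \<open>
  With all arc weights equal to 1, the shortest-path distance of the library is the infimum of
  the lengths of the walks from x to y; it is infinite if there is no such walk.
\<close>

definition graph_dist :: "'a pair_pre_digraph \<Rightarrow> 'a \<Rightarrow> 'a \<Rightarrow> ereal" where
  "graph_dist G x y = wf_digraph.\<mu> (with_proj G) (\<lambda>_. 1) x y"

definition couplings ::
    "'a pair_pre_digraph \<Rightarrow> ('a \<Rightarrow> real) \<Rightarrow> ('a \<Rightarrow> real) \<Rightarrow> ('a \<Rightarrow> 'a \<Rightarrow> real) set" where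
  "couplings G \<mu>1 \<mu>2 = {\<pi>.
     (\<forall>x\<in>pverts G. \<forall>y\<in>pverts G. \<pi> x y \<in> {0..1}) \<and>
     (\<forall>x\<in>pverts G. (\<Sum>y\<in>pverts G. \<pi> x y) = \<mu>1 x) \<and>
     (\<forall>y\<in>pverts G. (\<Sum>x\<in>pverts G. \<pi> x y) = \<mu>2 y)}"

text \<open>
  In \<^typ>\<open>ereal\<close> the product of infinity and 0 is 0, which is the convention wanted here.
\<close>

definition wasserstein :: "'a pair_pre_digraph \<Rightarrow> ('a \<Rightarrow> real) \<Rightarrow> ('a \<Rightarrow> real) \<Rightarrow> ereal" where
  "wasserstein G \<mu>1 \<mu>2 =
     (INF \<pi>\<in>couplings G \<mu>1 \<mu>2. \<Sum>x\<in>pverts G. \<Sum>y\<in>pverts G. graph_dist G x y * ereal (\<pi> x y))"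

definition lazy_walk :: "'a pair_pre_digraph \<Rightarrow> real \<Rightarrow> 'a \<Rightarrow> 'a \<Rightarrow> real" where
  "lazy_walk G \<alpha> x y =
     (if y = x then \<alpha>
      else if y \<in> neighbors G x then (1 - \<alpha>) / real (degree G x)
      else 0)"

definition ollivier_curvature :: "'a pair_pre_digraph \<Rightarrow> real \<Rightarrow> 'a \<Rightarrow> 'a \<Rightarrow> ereal" where
  "ollivier_curvature G \<alpha> x y = 1 - wasserstein G (lazy_walk G \<alpha> x) (lazy_walk G \<alpha> y)"

definition lly_curvature :: "'a pair_pre_digraph \<Rightarrow> 'a \<Rightarrow> 'a \<Rightarrow> ereal" where
  "lly_curvature G x y =
     Lim (at_left (1::real)) (\<lambda>\<alpha>. ollivier_curvature G \<alpha> x y / ereal (1 - \<alpha>))"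

definition Ric_ge :: "'a pair_pre_digraph \<Rightarrow> real \<Rightarrow> bool" where
  "Ric_ge G k \<longleftrightarrow> (\<forall>(x, y)\<in>parcs G. lly_curvature G x y \<ge> ereal k)"

end

theory Submission
  imports Defs
begin

text \<open>
  The degree condition forces any two vertices to be at distance at most 2, and it gives an edge
  \<open>xy\<close> with degrees \<open>d \<le> D\<close> at least \<open>(D - 3) / 2\<close> common neighbours.  Couple the two lazy
  walks by keeping their common mass in place, moving mass \<open>\<alpha> - (1 - \<alpha>) / d\<close> from \<open>x\<close> to
  \<open>y\<close> and the remaining mass arbitrarily, hence at distance at most 2.  The total cost is at
  most 1, so \<open>\<kappa>\<^sub>\<alpha>(x, y) \<ge> 0\<close> for \<open>\<alpha> \<ge> 1 / 2\<close>.  Since the curvature is a \<open>Lim\<close>, which is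
  unspecified without convergence, the existence of the limit has to be shown too: it holds
  because \<open>\<kappa>\<^sub>\<alpha>(x, y) / (1 - \<alpha>)\<close> is monotone in \<open>\<alpha>\<close>.
\<close>

section \<open>Left limits of monotone functions\<close>

text \<open>In a complete order the supremum exists without any bound on \<open>f\<close>. Once some
  value exceeds a given bound below the supremum, monotonicity keeps all later values above that
  bound.\<close>

lemma tendsto_at_left_SUP:
  fixes f :: "'a :: {linorder_topology, dense_order, no_bot} \<Rightarrow> 'b :: {complete_linorder, linorder_topology}"
  assumes "mono_on {a..<b} f" "a < b"
  shows "(f \<longlongrightarrow> (SUP x\<in>{a..<b}. f x)) (at_left b)"
proof (rule order_tendstoI)
  fix y assume "y < (SUP x\<in>{a..<b}. f x)"
  then obtain x where x: "x \<in> {a..<b}" "y < f x"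
    by (auto simp: less_SUP_iff)
  then have "eventually (\<lambda>t. t \<in> {x<..<b}) (at_left b)"
    by (intro eventually_at_leftI) auto
  then show "eventually (\<lambda>t. y < f t) (at_left b)"
  proof eventually_elim
    case (elim t)
    then have "f x \<le> f t"
      using x by (intro mono_onD[OF assms(1)]) auto
    with x show ?case by auto
  qed
next
  fix y assume y: "(SUP x\<in>{a..<b}. f x) < y"
  have "eventually (\<lambda>t. t \<in> {a<..<b}) (at_left b)"
    using assms by (intro eventually_at_leftI) auto
  then show "eventually (\<lambda>t. f t < y) (at_left b)"
  proof eventually_elim
    case (elim t)
    then have "f t \<le> (SUP x\<in>{a..<b}. f x)"
      by (intro SUP_upper) auto
    with y show ?case by auto
  qed
qed

lemma sum_sum_delta:
  fixes c :: "'c :: comm_monoid_add"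
  assumes "finite A" "finite B" "x \<in> A" "y \<in> B"
  shows "(\<Sum>u\<in>A. \<Sum>v\<in>B. if u = x then if v = y then c else 0 else 0) = c"
proof -
  have "(\<Sum>v\<in>B. if u = x then if v = y then c else 0 else 0) = (if u = x then c else 0)" for u
    using assms by simp
  then show ?thesis
    using assms by simp
qed

context pair_graph
begin

section \<open>Graph distance, neighbourhoods and arcs\<close>

lemma graph_dist_nonneg: "0 \<le> graph_dist G u v"
proof -
  have "0 \<le> awalk_cost (\<lambda>_. 1) p" for p :: "('a \<times> 'a) list"
    unfolding awalk_cost_def by (induct p) auto
  then show ?thesis
    unfolding graph_dist_def \<mu>_def by (auto intro!: INF_greatest)
qed

lemma graph_dist_le_length:
  assumes "awalk u p v"
  shows "graph_dist G u v \<le> ereal (real (length p))"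
proof -
  have "awalk_cost (\<lambda>_. 1) p = real (length p)"
    unfolding awalk_cost_def by (induct p) auto
  then show ?thesis
    unfolding graph_dist_def using min_cost_le_walk_cost[OF assms, of "\<lambda>_. 1"] by simp
qed

lemma graph_dist_self_le: "u \<in> pverts G \<Longrightarrow> graph_dist G u u \<le> 0"
  using graph_dist_le_length[of u "[]" u] by (simp add: awalk_Nil_iff zero_ereal_def)

lemma graph_dist_arc_le: "(u, v) \<in> parcs G \<Longrightarrow> graph_dist G u v \<le> 1"
  using graph_dist_le_length[of u "[(u, v)]" v]
  by (simp add: awalk_simps wellformed' one_ereal_def)

lemma graph_dist_two_arcs_le:
  "(u, w) \<in> parcs G \<Longrightarrow> (w, v) \<in> parcs G \<Longrightarrow> graph_dist G u v \<le> 2"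
  using graph_dist_le_length[of u "[(u, w), (w, v)]" v]
  by (simp add: awalk_simps wellformed')

lemma wasserstein_nonneg: "0 \<le> wasserstein G p q"
  unfolding wasserstein_def
  by (intro INF_greatest sum_nonneg ereal_0_le_mult graph_dist_nonneg) (auto simp: couplings_def)

lemma finite_neighbors: "finite (neighbors G x)"
  using pair_finite_verts by (auto simp: neighbors_def)

lemma in_neighborsI: "(x, y) \<in> parcs G \<Longrightarrow> y \<in> neighbors G x"
  by (auto simp: neighbors_def wellformed')

lemma not_in_neighbors_self: "x \<notin> neighbors G x"
  using pair_no_loops by (force simp: neighbors_def)

lemma arc_flip: "(x, y) \<in> parcs G \<Longrightarrow> (y, x) \<in> parcs G"
  using pair_sym_arcs by (auto simp: symmetric_def elim: symE)

section \<open>Transport cost from overlapping mass\<close>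

text \<open>The overlap stays in place at cost 0, mass \<open>t\<close> crosses the edge from
  \<open>x\<close> to \<open>y\<close> at cost 1, and the remaining mass \<open>M\<close> costs at
  most 2 per unit. The bound is \<open>t + 2 * M\<close>.\<close>

lemma wasserstein_le_overlap:
  assumes p: "\<And>u. u \<in> pverts G \<Longrightarrow> 0 \<le> p u" "(\<Sum>u\<in>pverts G. p u) = 1"
    and q: "\<And>u. u \<in> pverts G \<Longrightarrow> 0 \<le> q u" "(\<Sum>u\<in>pverts G. q u) = 1"
    and xy: "(x, y) \<in> parcs G"
    and diam: "\<And>u v. u \<in> pverts G \<Longrightarrow> v \<in> pverts G \<Longrightarrow> graph_dist G u v \<le> 2"
    and t: "0 \<le> t" "t \<le> p x - min (p x) (q x)" "t \<le> q y - min (p y) (q y)"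
  shows "wasserstein G p q \<le> ereal (2 - t - 2 * (\<Sum>u\<in>pverts G. min (p u) (q u)))"
proof -
  let ?V = "pverts G"
  have V: "finite ?V" "x \<in> ?V" "y \<in> ?V"
    using pair_finite_verts xy by (auto simp: wellformed')
  define w where "w u = min (p u) (q u)" for u
  \<comment> \<open>\<open>g\<close> and \<open>h\<close> are the masses still to be sent and received; both have total mass \<open>M\<close>,
    and the product coupling below is junk-free for \<open>M = 0\<close> because then \<open>g\<close> and \<open>h\<close> vanish.\<close>
  define g where "g u = p u - w u - (if u = x then t else 0)" for u
  define h where "h u = q u - w u - (if u = y then t else 0)" for u
  define M where "M = 1 - t - (\<Sum>u\<in>?V. w u)"
  have g0: "0 \<le> g u" and h0: "0 \<le> h u" and w0: "u \<in> ?V \<Longrightarrow> 0 \<le> w u" for u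
    using t p(1) q(1) by (auto simp: g_def h_def w_def)
  have gM: "sum g ?V = M" and hM: "sum h ?V = M"
    using V p(2) q(2) by (simp_all add: g_def h_def M_def sum_subtractf)
  have M0: "0 \<le> M"
    using gM g0 by (metis sum_nonneg)
  have gz: "g u = 0" and hz: "h u = 0" if "M = 0" "u \<in> ?V" for u
    using that gM hM V g0 h0 sum_nonneg_eq_0_iff[of ?V g] sum_nonneg_eq_0_iff[of ?V h] by auto
  \<comment> \<open>Since 2 bounds every distance, the remainder needs no optimisation; the product
    \<open>g u * h v / M\<close> is simply a plan with marginals \<open>g\<close> and
    \<open>h\<close>.\<close>
  define \<pi> where "\<pi> u v = (if u = v then w u else 0) +
      (if u = x then if v = y then t else 0 else 0) + g u * h v / M" for u v
  have \<pi>0: "0 \<le> \<pi> u v" if "u \<in> ?V" "v \<in> ?V" for u v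
    using that w0 g0 h0 M0 t unfolding \<pi>_def by auto
  have gh1: "(\<Sum>v\<in>?V. g u * h v / M) = g u" if "u \<in> ?V" for u
    using gz[OF _ that] by (cases "M = 0") (simp_all add: hM flip: sum_distrib_left sum_divide_distrib)
  have gh2: "(\<Sum>u\<in>?V. g u * h v / M) = h v" if "v \<in> ?V" for v
    using hz[OF _ that] by (cases "M = 0") (simp_all add: gM flip: sum_distrib_right sum_divide_distrib)
  have row: "(\<Sum>v\<in>?V. \<pi> u v) = p u" if "u \<in> ?V" for u
    using that V gh1[OF that] by (simp add: \<pi>_def sum.distrib g_def)
  have col: "(\<Sum>u\<in>?V. \<pi> u v) = q v" if "v \<in> ?V" for v
    using that V gh2[OF that] by (simp add: \<pi>_def sum.distrib h_def)
  have \<pi>1: "\<pi> u v \<le> 1" if "u \<in> ?V" "v \<in> ?V" for u v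
  proof -
    have "\<pi> u v \<le> (\<Sum>v\<in>?V. \<pi> u v)"
      using that V \<pi>0 by (intro member_le_sum) auto
    also have "\<dots> \<le> (\<Sum>u\<in>?V. p u)"
      using row that V p by (metis member_le_sum DiffD1)
    finally show ?thesis using p by simp
  qed
  have "\<pi> \<in> couplings G p q"
    unfolding couplings_def using \<pi>0 \<pi>1 row col by auto
  then have "wasserstein G p q \<le> (\<Sum>u\<in>?V. \<Sum>v\<in>?V. graph_dist G u v * ereal (\<pi> u v))"
    unfolding wasserstein_def by (rule INF_lower)
  also have "\<dots> \<le> (\<Sum>u\<in>?V. \<Sum>v\<in>?V. ereal
      ((if u = x then if v = y then t else 0 else 0) + 2 * (g u * h v / M)))"
  proof (intro sum_mono)
    fix u v assume uv: "u \<in> ?V" "v \<in> ?V"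
    define c :: real where "c = (if u = v then 0 else if u = x \<and> v = y then 1 else 2)"
    have "graph_dist G u v \<le> ereal c"
      using diam uv graph_dist_self_le graph_dist_arc_le[OF xy]
      by (auto simp: c_def zero_ereal_def one_ereal_def)
    then have "graph_dist G u v * ereal (\<pi> u v) \<le> ereal c * ereal (\<pi> u v)"
      using \<pi>0[OF uv] by (intro ereal_mult_right_mono) auto
    \<comment> \<open>On the diagonal \<open>c = 0\<close> removes everything; the edge term is not
      there because \<open>x\<close> and \<open>y\<close> differ. At \<open>(x, y)\<close> the
      product term costs 1 and is overestimated by 2.\<close>
    also have "c * \<pi> u v \<le>
        (if u = x then if v = y then t else 0 else 0) + 2 * (g u * h v / M)"
      using t pair_no_loops[OF xy] divide_nonneg_nonneg[OF mult_nonneg_nonneg[OF g0 h0] M0, of u v]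
      by (auto simp: c_def \<pi>_def)
    then have "ereal c * ereal (\<pi> u v) \<le> ereal
        ((if u = x then if v = y then t else 0 else 0) + 2 * (g u * h v / M))"
      by simp
    finally show "graph_dist G u v * ereal (\<pi> u v) \<le> ereal
        ((if u = x then if v = y then t else 0 else 0) + 2 * (g u * h v / M))" .
  qed
  also have "\<dots> = ereal (t + 2 * (\<Sum>u\<in>?V. \<Sum>v\<in>?V. g u * h v / M))"
    using V by (simp add: sum.distrib sum_sum_delta sum_distrib_left)
  also have "(\<Sum>u\<in>?V. \<Sum>v\<in>?V. g u * h v / M) = M"
    using gh1 gM by simp
  also have "t + 2 * M = 2 - t - 2 * (\<Sum>u\<in>?V. min (p u) (q u))"
    by (simp add: M_def w_def)
  finally show ?thesis .
qed

section \<open>Lazy walks and their dependence on the idleness\<close>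

lemma sum_lazy_walk:
  assumes "x \<in> pverts G" "neighbors G x \<noteq> {}"
  shows "(\<Sum>u\<in>pverts G. lazy_walk G \<alpha> x u) = 1"
proof -
  have "(\<Sum>u\<in>pverts G. lazy_walk G \<alpha> x u) = (\<Sum>u\<in>insert x (neighbors G x). lazy_walk G \<alpha> x u)"
    using assms pair_finite_verts
    by (intro sum.mono_neutral_right) (auto simp: lazy_walk_def neighbors_def)
  also have "\<dots> = \<alpha> + (\<Sum>u\<in>neighbors G x. (1 - \<alpha>) / real (degree G x))"
  proof -
    have "(\<Sum>u\<in>neighbors G x. lazy_walk G \<alpha> x u) =
        (\<Sum>u\<in>neighbors G x. (1 - \<alpha>) / real (degree G x))"
      using not_in_neighbors_self by (intro sum.cong) (auto simp: lazy_walk_def)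
    then show ?thesis
      using finite_neighbors not_in_neighbors_self by (simp add: lazy_walk_def)
  qed
  also have "\<dots> = 1"
    using assms finite_neighbors by (simp add: degree_def)
  finally show ?thesis .
qed

text \<open>
  Mixing a coupling for the idleness \<open>\<alpha>\<close> with the unit mass at \<open>(x, y)\<close> gives a
  coupling for the idleness \<open>\<beta>\<close>.
\<close>

lemma wasserstein_lazy_walk_le:
  assumes xy: "(x, y) \<in> parcs G" and ab: "0 \<le> \<alpha>" "\<alpha> \<le> \<beta>" "\<beta> < 1"
    and fin: "wasserstein G (lazy_walk G \<beta> x) (lazy_walk G \<beta> y) = ereal b"
      "wasserstein G (lazy_walk G \<alpha> x) (lazy_walk G \<alpha> y) = ereal a"
  shows "(1 - a) / (1 - \<alpha>) \<le> (1 - b) / (1 - \<beta>)"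
proof -
  let ?V = "pverts G"
  have V: "finite ?V" "x \<in> ?V" "y \<in> ?V"
    using pair_finite_verts xy by (auto simp: wellformed')
  define l where "l = (1 - \<beta>) / (1 - \<alpha>)"
  have l: "0 < l" "l \<le> 1" and l_eq: "l * (1 - \<alpha>) = 1 - \<beta>"
    using ab by (auto simp: l_def)
  \<comment> \<open>The choice of \<open>l\<close> makes the lazier walk a convex combination of the
    other one and the point mass at its start, since \<beta> =
    \<open>l * \<alpha> + (1 - l)\<close>.\<close>
  have lw: "lazy_walk G \<beta> z u = l * lazy_walk G \<alpha> z u + (if u = z then 1 - l else 0)" for z u
    using l_eq by (simp add: lazy_walk_def algebra_simps)
  \<comment> \<open>This is \<open>b \<le> l * a + (1 - l)\<close> solved for \<open>a\<close>, so
    that it can be checked against each coupling separately.\<close>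
  have "ereal ((b - (1 - l)) / l) \<le> ereal a"
    unfolding fin(2)[symmetric] wasserstein_def
  proof (rule INF_greatest)
    fix \<pi> assume \<pi>: "\<pi> \<in> couplings G (lazy_walk G \<alpha> x) (lazy_walk G \<alpha> y)"
    define \<rho> where "\<rho> u v = l * \<pi> u v + (if u = x then if v = y then 1 - l else 0 else 0)" for u v
    let ?c = "\<lambda>\<pi>. \<Sum>u\<in>?V. \<Sum>v\<in>?V. graph_dist G u v * ereal (\<pi> u v)"
    have \<pi>01: "0 \<le> \<pi> u v" "\<pi> u v \<le> 1" if "u \<in> ?V" "v \<in> ?V" for u v
      using \<pi> that by (auto simp: couplings_def)
    have \<rho>01: "\<rho> u v \<in> {0..1}" if "u \<in> ?V" "v \<in> ?V" for u v
      using \<pi>01[OF that] l mult_le_one[of l "\<pi> u v"] by (auto simp: \<rho>_def)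
    have "(\<Sum>v\<in>?V. \<rho> u v) = lazy_walk G \<beta> x u" if "u \<in> ?V" for u
      using that \<pi> V by (simp add: \<rho>_def couplings_def sum.distrib lw flip: sum_distrib_left)
    moreover have "(\<Sum>u\<in>?V. \<rho> u v) = lazy_walk G \<beta> y v" if "v \<in> ?V" for v
      using that \<pi> V by (simp add: \<rho>_def couplings_def sum.distrib lw flip: sum_distrib_left)
    ultimately have "\<rho> \<in> couplings G (lazy_walk G \<beta> x) (lazy_walk G \<beta> y)"
      using \<rho>01 by (auto simp: couplings_def)
    then have "ereal b \<le> ?c \<rho>"
      unfolding fin(1)[symmetric] wasserstein_def by (rule INF_lower)
    also have "\<dots> \<le> (\<Sum>u\<in>?V. \<Sum>v\<in>?V. ereal l * (graph_dist G u v * ereal (\<pi> u v)) +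
        (if u = x then if v = y then ereal (1 - l) else 0 else 0))"
    proof (intro sum_mono)
      fix u v assume uv: "u \<in> ?V" "v \<in> ?V"
      let ?e = "if u = x then if v = y then ereal (1 - l) else 0 else 0"
      have e: "ereal (\<rho> u v) = ereal l * ereal (\<pi> u v) + ?e"
        by (auto simp: \<rho>_def)
      \<comment> \<open>Distances may be infinite here, so distributivity in \<open>ereal\<close>
        rests on the nonnegativity of both summands.\<close>
      have "graph_dist G u v * ereal (\<rho> u v) =
          graph_dist G u v * (ereal l * ereal (\<pi> u v)) + graph_dist G u v * ?e"
        unfolding e using l \<pi>01[OF uv] by (intro ereal_right_distrib) auto
      also have "graph_dist G u v * (ereal l * ereal (\<pi> u v)) =
          ereal l * (graph_dist G u v * ereal (\<pi> u v))"
        by (simp add: mult_ac del: times_ereal.simps)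
      also have "graph_dist G u v * ?e \<le> ?e"
        using l ereal_mult_right_mono[OF graph_dist_arc_le[OF xy], of "ereal (1 - l)"] by auto
      finally show "graph_dist G u v * ereal (\<rho> u v) \<le>
          ereal l * (graph_dist G u v * ereal (\<pi> u v)) + ?e"
        by (simp add: add_left_mono)
    qed
    also have "\<dots> = ereal l * ?c \<pi> + ereal (1 - l)"
      using V l \<pi>01 graph_dist_nonneg
      by (simp add: sum.distrib sum_sum_delta sum_ereal_right_distrib sum_nonneg)
    finally have *: "ereal b \<le> ereal l * ?c \<pi> + ereal (1 - l)" .
    show "ereal ((b - (1 - l)) / l) \<le> ?c \<pi>"
    proof (cases "?c \<pi>")
      case (real r)
      then show ?thesis
        using * l by (simp add: field_simps)
    next
      case MInf
      then show ?thesis using * l by simp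
    qed simp
  qed
  then have "l * (1 - a) \<le> 1 - b"
    using l by (simp add: field_simps)
  then show ?thesis
    using ab by (simp add: l_def field_simps)
qed

end

section \<open>Consequences of the degree condition\<close>

text \<open>From idleness 1/2 on, the idle mass is at least any neighbour's share, so the overlaps
  at \<open>x\<close> and \<open>y\<close> are the neighbour shares. The overlap bound then reduces
  the claim to \<open>D \<le> 2 * card C + 3\<close>.\<close>

lemma wasserstein_lazy_walk_le_1:
  assumes "pair_graph G" and xy: "(x, y) \<in> parcs G"
    and deg: "\<And>z. z \<in> pverts G \<Longrightarrow> 2 * card (pverts G) \<le> 3 * degree G z + 3"
    and a: "1 / 2 \<le> \<alpha>" "\<alpha> < 1"
  shows "wasserstein G (lazy_walk G \<alpha> x) (lazy_walk G \<alpha> y) \<le> 1"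
proof -
  interpret pair_graph G by fact
  let ?V = "pverts G" and ?N = "neighbors G"
  let ?p = "lazy_walk G \<alpha> x" and ?q = "lazy_walk G \<alpha> y"
  have V: "finite ?V" "x \<in> ?V" "y \<in> ?V" and yx: "(y, x) \<in> parcs G" and ne: "x \<noteq> y"
    using pair_finite_verts xy arc_flip pair_no_loops[OF xy] by (auto simp: wellformed')
  have N: "finite (?N z)" "?N z \<subseteq> ?V" "z \<notin> ?N z" "card (?N z) = degree G z" for z
    using finite_neighbors not_in_neighbors_self by (auto simp: neighbors_def degree_def)
  have inN: "y \<in> ?N x" "x \<in> ?N y"
    using xy yx by (auto intro: in_neighborsI)
  have diam: "graph_dist G u v \<le> 2" if uv: "u \<in> ?V" "v \<in> ?V" for u v
  proof -
    consider "u = v" | "(u, v) \<in> parcs G" | "u \<noteq> v" "v \<notin> ?N u" "u \<notin> ?N v"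
      using uv arc_flip by (auto simp: neighbors_def)
    then show ?thesis
    proof cases
      case 1
      then show ?thesis
        using order_trans[OF graph_dist_self_le[OF uv(1)], of 2] by auto
    next
      case 2
      then show ?thesis
        using order_trans[OF graph_dist_arc_le, of u v 2] by auto
    next
      case 3
      \<comment> \<open>With n vertices, both neighbourhoods lie in a set of n - 2 elements and have
        at least (2n - 3)/3 elements each. As 2(2n - 3)/3 > n - 2, they meet.\<close>
      have "card (?N u \<union> ?N v) \<le> card (?V - {u, v})"
        using 3 N V by (intro card_mono) auto
      also have "\<dots> < card ?V - 1"
        using 3 uv V card_mono[of ?V "{u, v}"] by (simp add: card_Diff_subset)
      finally have "?N u \<inter> ?N v \<noteq> {}"
        using card_Un_Int[of "?N u" "?N v"] N deg[OF uv(1)] deg[OF uv(2)] by auto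
      then obtain w where "(u, w) \<in> parcs G" "(v, w) \<in> parcs G"
        by (auto simp: neighbors_def)
      then show ?thesis
        using arc_flip graph_dist_two_arcs_le by blast
    qed
  qed
  define C where "C = ?N x \<inter> ?N y"
  define D d where "D = max (degree G x) (degree G y)" and "d = min (degree G x) (degree G y)"
  have pos: "0 < degree G x" "0 < degree G y"
    using inN N(1) by (auto simp: degree_def card_gt_0_iff)
  have Dd: "0 < d" "d \<le> D"
    using pos by (auto simp: D_def d_def)
  have dd: "d = degree G x \<and> D = degree G y \<or> D = degree G x \<and> d = degree G y"
    by (auto simp: D_def d_def)
  have "card (?N x \<union> ?N y) \<le> card ?V"
    using N V by (intro card_mono) auto
  then have "D + d \<le> card ?V + card C"
    using card_Un_Int[of "?N x" "?N y"] N dd by (auto simp: C_def)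
  moreover have "2 * card ?V \<le> 3 * d + 3"
    using dd deg V by auto
  \<comment> \<open>Doubling the first inequality and inserting the second gives
    \<open>2 * D \<le> d + 3 + 2 * card C\<close>; then use \<open>d \<le> D\<close>.\<close>
  ultimately have key: "D \<le> 2 * card C + 3"
    using Dd by linarith
  \<comment> \<open>The smaller of the excesses at \<open>x\<close> and \<open>y\<close>, hence the
    most that the edge can carry.\<close>
  define t where "t = \<alpha> - (1 - \<alpha>) / d"
  have ale: "(1 - \<alpha>) / degree G x \<le> \<alpha>" "(1 - \<alpha>) / degree G y \<le> \<alpha>" "(1 - \<alpha>) / d \<le> \<alpha>"
  proof -
    have "(1 - \<alpha>) / real k \<le> \<alpha>" if "0 < k" for k
    proof -
      have "(1 - \<alpha>) / real k \<le> (1 - \<alpha>) / 1"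
        using that a by (intro divide_left_mono) auto
      then show ?thesis using a by simp
    qed
    then show "(1 - \<alpha>) / degree G x \<le> \<alpha>" "(1 - \<alpha>) / degree G y \<le> \<alpha>" "(1 - \<alpha>) / d \<le> \<alpha>"
      using pos Dd by auto
  qed
  have dle: "(1 - \<alpha>) / degree G x \<le> (1 - \<alpha>) / d" "(1 - \<alpha>) / degree G y \<le> (1 - \<alpha>) / d"
    using a pos Dd by (auto simp: d_def intro!: divide_left_mono)
  have dmin: "min ((1 - \<alpha>) / degree G x) ((1 - \<alpha>) / degree G y) = (1 - \<alpha>) / D"
    using a pos unfolding D_def
    by (cases "degree G x \<le> degree G y") (simp_all add: min_absorb1 min_absorb2 frac_le)
  have val: "?p x = \<alpha>" "?q y = \<alpha>" "?p y = (1 - \<alpha>) / degree G x" "?q x = (1 - \<alpha>) / degree G y"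
    using inN ne by (auto simp: lazy_walk_def)
  have nn: "0 \<le> lazy_walk G \<alpha> z u" for z u
    using a by (auto simp: lazy_walk_def)
  have "wasserstein G ?p ?q \<le> ereal (2 - t - 2 * (\<Sum>u\<in>?V. min (?p u) (?q u)))"
    using inN V nn diam ale dle
    by (intro wasserstein_le_overlap[OF _ _ _ _ xy] sum_lazy_walk) (auto simp: t_def val)
  also have "2 - t - 2 * (\<Sum>u\<in>?V. min (?p u) (?q u)) \<le> 1"
  proof -
    have "(1 - \<alpha>) / d + (1 - \<alpha>) / D + card C * ((1 - \<alpha>) / D) =
        (\<Sum>u\<in>insert x (insert y C). min (?p u) (?q u))"
    proof -
      have "(\<Sum>u\<in>C. min (?p u) (?q u)) = (\<Sum>u\<in>C. (1 - \<alpha>) / D)"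
      proof (intro sum.cong refl)
        fix u assume u: "u \<in> C"
        then have "u \<noteq> x" "u \<noteq> y"
          using N by (auto simp: C_def)
        with u show "min (?p u) (?q u) = (1 - \<alpha>) / D"
          using dmin by (auto simp: C_def lazy_walk_def)
      qed
      moreover have "x \<notin> insert y C" "y \<notin> C" "finite C"
        using N ne by (auto simp: C_def)
      ultimately show ?thesis
        using ale dd by (auto simp: val)
    qed
    also have "\<dots> \<le> (\<Sum>u\<in>?V. min (?p u) (?q u))"
      using N V nn by (intro sum_mono2) (auto simp: C_def)
    finally have "2 - t - 2 * (\<Sum>u\<in>?V. min (?p u) (?q u)) \<le>
        2 - t - 2 * ((1 - \<alpha>) / d + (1 - \<alpha>) / D + card C * ((1 - \<alpha>) / D))"
      by (rule diff_left_mono[OF mult_left_mono]) simp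
    also have "\<dots> = 2 - \<alpha> - (1 - \<alpha>) / d - (1 - \<alpha>) * ((2 * card C + 2) / D)"
      by (simp add: t_def add_divide_distrib diff_divide_distrib algebra_simps)
    \<comment> \<open>Weakening \<open>d\<close> to \<open>D\<close> collects everything into
      \<open>(2 * card C + 3) / D\<close>, which is at least 1 by \<open>key\<close>.\<close>
    also have "\<dots> \<le> 2 - \<alpha> - (1 - \<alpha>) / D - (1 - \<alpha>) * ((2 * card C + 2) / D)"
      using Dd a by (simp add: frac_le)
    also have "\<dots> = 2 - \<alpha> - (1 - \<alpha>) * ((2 * card C + 3) / D)"
      using Dd by (simp add: field_simps)
    also have "\<dots> \<le> 2 - \<alpha> - (1 - \<alpha>) * 1"
      using key Dd a by (intro diff_mono mult_left_mono) auto
    finally show ?thesis by simp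
  qed
  finally show ?thesis
    by (simp add: one_ereal_def)
qed

theorem theorem1p1:
  fixes G :: "'a pair_pre_digraph"
  assumes "pair_graph G"
    and "pverts G \<noteq> {}"
    and "real (min_degree G) \<ge> 2 * real (card (pverts G)) / 3 - 1"
  shows "Ric_ge G 0"
proof -
  interpret pair_graph G by fact
  have deg: "2 * card (pverts G) \<le> 3 * degree G z + 3" if "z \<in> pverts G" for z
  proof -
    have "min_degree G \<le> degree G z"
      unfolding min_degree_def using pair_finite_verts that by (intro Min_le) auto
    then show ?thesis
      using assms(3) by linarith
  qed
  have "0 \<le> lly_curvature G x y" if xy: "(x, y) \<in> parcs G" for x y
  proof -
    define W where "W \<alpha> = wasserstein G (lazy_walk G \<alpha> x) (lazy_walk G \<alpha> y)" for \<alpha>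
    define w where "w \<alpha> = real_of_ereal (W \<alpha>)" for \<alpha>
    define f where "f \<alpha> = ollivier_curvature G \<alpha> x y / ereal (1 - \<alpha>)" for \<alpha>
    \<comment> \<open>Lying between 0 and 1 makes the distance finite, so the quotient can be
      treated as a real number.\<close>
    have W: "W \<alpha> = ereal (w \<alpha>)" and w1: "w \<alpha> \<le> 1" if "\<alpha> \<in> {1 / 2..<1}" for \<alpha>
    proof -
      have "0 \<le> W \<alpha>" "W \<alpha> \<le> 1"
        unfolding W_def
        using that wasserstein_lazy_walk_le_1[OF assms(1) xy deg] wasserstein_nonneg by auto
      then show "W \<alpha> = ereal (w \<alpha>)" "w \<alpha> \<le> 1"
        by (cases "W \<alpha>"; auto simp: w_def)+
    qed
    have f: "f \<alpha> = ereal ((1 - w \<alpha>) / (1 - \<alpha>))" if "\<alpha> \<in> {1 / 2..<1}" for \<alpha>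
      using W[OF that] that
      by (simp add: f_def ollivier_curvature_def W_def[symmetric] one_ereal_def)
    have "mono_on {1 / 2..<1} f"
    proof (rule mono_onI)
      fix \<alpha> \<beta> :: real
      assume ab: "\<alpha> \<in> {1 / 2..<1}" "\<beta> \<in> {1 / 2..<1}" "\<alpha> \<le> \<beta>"
      then show "f \<alpha> \<le> f \<beta>"
        using wasserstein_lazy_walk_le[OF xy _ _ _ W[unfolded W_def] W[unfolded W_def], of \<alpha> \<beta>]
        by (simp add: f)
    qed
    then have lim: "(f \<longlongrightarrow> (SUP \<alpha>\<in>{1 / 2..<1}. f \<alpha>)) (at_left 1)"
      by (intro tendsto_at_left_SUP) auto
    \<comment> \<open>The limit is a supremum, so the sign at the single idleness 1/2
      suffices.\<close>
    have "0 \<le> f (1 / 2)"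
      using f[of "1 / 2"] w1[of "1 / 2"] by simp
    also have "\<dots> \<le> (SUP \<alpha>\<in>{1 / 2..<1}. f \<alpha>)"
      by (intro SUP_upper) auto
    also have "\<dots> = lly_curvature G x y"
      unfolding lly_curvature_def using tendsto_Lim[OF _ lim] by (simp add: f_def[abs_def])
    finally show ?thesis .
  qed
  then show ?thesis
    by (auto simp: Ric_ge_def zero_ereal_def[symmetric])
qed

end
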